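(* Let $\mathcal{E}$ be a 1-dimensional exponential family defined over a finite set $\Omega=\{x_0,\dots,x_m\}$ (with the counting measure), with elements of the form $p(x;\theta)=\exp\{C(x)+\theta F(x)-\psi(\theta)\}$, where $C,F:\Omega\to\mathbb{R}$, $\theta\in\mathbb{R}$ and $\psi:\mathbb{R}\to\mathbb{R}$. Suppose that $\mathrm{Im}(F)=\{\alpha_0<\dots<\alpha_p\}$. For $i=0,\dots,p$, define $\omega_i\in\mathbb{R}$ by $$e^{\omega_i}=\sum_{x\in F^{-1}(\alpha_i)}e^{C(x)}.$$ Then the scalar curvature $\mathrm{Scal}:T\mathcal{E}\to\mathbb{R}$ is constant if and only if there exist $r,s\in\mathbb{R}$ such that $$\alpha_k=\alpha_0+\frac{k}{p}(\alpha_p-\alpha_0)\quad\text{and}\quad \omega_k=rk+s(p-k)+\ln\binom{p}{k}$$ for all $k=0,\dots,p$; and in that case, $\mathrm{Scal}\equiv\frac{2}{p}$.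
   Context: A 1-dimensional exponential family $\mathcal{E}$ over a finite set $\Omega=\{x_0,\dots,x_m\}$ with the counting measure is a set of probability functions $p(x;\theta)=\exp\{C(x)+\theta F(x)-\psi(\theta)\}$, $\theta\in\mathbb{R}$, where $C,F:\Omega\to\mathbb{R}$ and $F$ is assumed linearly independent from the constant function $1$ (i.e. $F$ is not constant). Normalization forces $\psi(\theta)=\ln\sum_{k=0}^m e^{C(x_k)+\theta F(x_k)}$. The parameter $\theta$ is a global chart, making $\mathcal{E}$ a 1-dimensional manifold. The Fisher metric on $\mathcal{E}$ is given by $h_F(\theta)=\sum_{x\in\Omega}(\partial_\theta\ln p(x;\theta))^2\,p(x;\theta)=\psi''(\theta)$. The exponential connection $\nabla^{(e)}$ is the flat connection for which $\theta$ is an affine coordinate. Let $(q,r)$ be the coordinates on $T\mathcal{E}$ for which $(q,r)$ represents the tangent vector $r\,\frac{\partial}{\partial\theta}$ at the point $\theta=q$. The Kähler metric on $T\mathcal{E}$ associated to $(h_F,\nabla^{(e)})$ by Dombrowski's construction is $g=h_F(q)(dq^2+dr^2)$. $\mathrm{Scal}:T\mathcal{E}\to\mathbb{R}$ is the scalar curvature (trace of the Ricci tensor) of $g$; explicitly $\mathrm{Scal}(q,r)=-\frac{1}{h_F(q)}\frac{d^2}{dq^2}\ln h_F(q)$. *)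

theory Defs
  imports "HOL-Analysis.Analysis"
begin

section \<open>Curvature of a Riemannian metric in a global chart\<close>

text \<open>
  A metric is given by its component matrix \<open>g x\<close> at each point \<open>x\<close> of the coordinate
  space \<open>real ^ 'n\<close>.
\<close>

definition partial :: "'n::finite \<Rightarrow> (real ^ 'n \<Rightarrow> real) \<Rightarrow> real ^ 'n \<Rightarrow> real" where
  "partial i f x = deriv (\<lambda>t. f (x + t *\<^sub>R axis i 1)) 0"

text \<open>\<open>christoffel g k i j\<close> is the symbol with upper index \<open>k\<close> and lower indices \<open>i, j\<close>.\<close>

definition christoffel ::
  "(real ^ 'n \<Rightarrow> real ^ 'n ^ 'n) \<Rightarrow> 'n::finite \<Rightarrow> 'n \<Rightarrow> 'n \<Rightarrow> real ^ 'n \<Rightarrow> real" where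
  "christoffel g k i j x =
     (\<Sum>l\<in>UNIV. matrix_inv (g x) $ k $ l *
        (partial i (\<lambda>y. g y $ j $ l) x + partial j (\<lambda>y. g y $ i $ l) x
          - partial l (\<lambda>y. g y $ i $ j) x)) / 2"

text \<open>
  \<open>riemann g l k i j\<close> is the \<open>l\<close>-th component of \<open>R(\<partial>\<^sub>i, \<partial>\<^sub>j) \<partial>\<^sub>k\<close>, where
  \<open>R(X, Y) = \<nabla>\<^sub>X \<nabla>\<^sub>Y - \<nabla>\<^sub>Y \<nabla>\<^sub>X - \<nabla>\<^bsub>[X, Y]\<^esub>\<close>.
\<close>

definition riemann ::
  "(real ^ 'n \<Rightarrow> real ^ 'n ^ 'n) \<Rightarrow> 'n::finite \<Rightarrow> 'n \<Rightarrow> 'n \<Rightarrow> 'n \<Rightarrow> real ^ 'n \<Rightarrow> real" where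
  "riemann g l k i j x =
     partial i (christoffel g l j k) x - partial j (christoffel g l i k) x
     + (\<Sum>m\<in>UNIV. christoffel g l i m x * christoffel g m j k x
                 - christoffel g l j m x * christoffel g m i k x)"

text \<open>\<open>Ric(Y, Z)\<close> is the trace of \<open>X \<mapsto> R(X, Y) Z\<close>.\<close>

definition ricci ::
  "(real ^ 'n \<Rightarrow> real ^ 'n ^ 'n) \<Rightarrow> 'n::finite \<Rightarrow> 'n \<Rightarrow> real ^ 'n \<Rightarrow> real" where
  "ricci g j k x = (\<Sum>i\<in>UNIV. riemann g i k i j x)"

definition scalar_curvature ::
  "(real ^ 'n::finite \<Rightarrow> real ^ 'n ^ 'n) \<Rightarrow> real ^ 'n \<Rightarrow> real" where
  "scalar_curvature g x =
     (\<Sum>j\<in>UNIV. \<Sum>k\<in>UNIV. matrix_inv (g x) $ j $ k * ricci g j k x)"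


section \<open>One-dimensional exponential families over a finite set\<close>

definition prob :: "('a \<Rightarrow> real) \<Rightarrow> ('a \<Rightarrow> real) \<Rightarrow> (real \<Rightarrow> real) \<Rightarrow> 'a \<Rightarrow> real \<Rightarrow> real" where
  "prob C F \<psi> x \<theta> = exp (C x + \<theta> * F x - \<psi> \<theta>)"

text \<open>The last condition says that \<open>1\<close> and \<open>F\<close> are linearly independent as functions on \<open>\<Omega>\<close>.\<close>

definition exponential_family ::
  "'a set \<Rightarrow> ('a \<Rightarrow> real) \<Rightarrow> ('a \<Rightarrow> real) \<Rightarrow> (real \<Rightarrow> real) \<Rightarrow> bool" where
  "exponential_family \<Omega> C F \<psi> \<longleftrightarrow>
     finite \<Omega> \<and>
     (\<forall>\<theta>. (\<Sum>x\<in>\<Omega>. prob C F \<psi> x \<theta>) = 1) \<and>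
     (\<forall>a b. (\<forall>x\<in>\<Omega>. a * 1 + b * F x = 0) \<longrightarrow> a = 0 \<and> b = 0)"

definition fisher ::
  "'a set \<Rightarrow> ('a \<Rightarrow> real) \<Rightarrow> ('a \<Rightarrow> real) \<Rightarrow> (real \<Rightarrow> real) \<Rightarrow> real \<Rightarrow> real" where
  "fisher \<Omega> C F \<psi> \<theta> =
     (\<Sum>x\<in>\<Omega>. (deriv (\<lambda>t. ln (prob C F \<psi> x t)) \<theta>)\<^sup>2 * prob C F \<psi> x \<theta>)"

text \<open>
  The tangent bundle is described by its global chart: the vector \<open>u\<close> with components
  \<open>u $ 1 = q\<close> and \<open>u $ 2 = r\<close> stands for the tangent vector \<open>r \<partial>/\<partial>\<theta>\<close> at \<open>\<theta> = q\<close>.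
  Since \<open>\<theta>\<close> is an affine coordinate of the exponential connection, the horizontal lift of
  \<open>\<partial>/\<partial>\<theta>\<close> is \<open>\<partial>/\<partial>q\<close> and the vertical lift is \<open>\<partial>/\<partial>r\<close>, so that Dombrowski's metric is
  \<open>h(q) (dq\<^sup>2 + dr\<^sup>2)\<close>, with \<open>h\<close> the Fisher metric.
\<close>

definition dombrowski_metric ::
  "'a set \<Rightarrow> ('a \<Rightarrow> real) \<Rightarrow> ('a \<Rightarrow> real) \<Rightarrow> (real \<Rightarrow> real) \<Rightarrow> real ^ 2 \<Rightarrow> real ^ 2 ^ 2" where
  "dombrowski_metric \<Omega> C F \<psi> u = mat (fisher \<Omega> C F \<psi> (u $ 1))"

definition Scal ::
  "'a set \<Rightarrow> ('a \<Rightarrow> real) \<Rightarrow> ('a \<Rightarrow> real) \<Rightarrow> (real \<Rightarrow> real) \<Rightarrow> real ^ 2 \<Rightarrow> real" where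
  "Scal \<Omega> C F \<psi> = scalar_curvature (dombrowski_metric \<Omega> C F \<psi>)"

end

theory Submission
  imports Defs
begin

text \<open>
  With \<open>Z(\<theta>) = \<Sum>\<^sub>k exp(\<omega>\<^sub>k + \<theta>\<alpha>\<^sub>k)\<close> we have \<open>\<psi> = ln Z\<close>; let \<open>m = \<psi>'\<close> be the mean and
  \<open>h = m' = \<psi>''\<close> the variance of \<open>F\<close>. If the scalar curvature \<open>-(ln h)''/h\<close> is the constant \<open>c\<close>,
  then integrating twice shows that \<open>h\<close> is a quadratic polynomial in \<open>m\<close> with leading coefficient
  \<open>-c/2\<close>. As \<open>\<theta>\<close> tends to \<open>\<plusminus>\<infinity>\<close>, \<open>m\<close> tends to \<open>\<alpha>\<^sub>p\<close> resp. \<open>\<alpha>\<^sub>0\<close> and \<open>h\<close> to \<open>0\<close>, so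
  \<open>h = (c/2)(m - \<alpha>\<^sub>0)(\<alpha>\<^sub>p - m)\<close>. This logistic equation for \<open>m\<close> is equivalent to
  \<open>m - \<alpha>\<^sub>0 = K exp(\<mu>\<theta>) (\<alpha>\<^sub>p - m)\<close> with \<open>\<mu> = (c/2)(\<alpha>\<^sub>p - \<alpha>\<^sub>0)\<close>. Multiplied by \<open>Z\<close>, it is an
  identity between two exponential sums with \<open>p\<close> nonzero terms each; by linear independence of
  exponentials it says \<open>\<alpha>\<^bsub>k+1\<^esub> = \<alpha>\<^sub>k + \<mu>\<close> and
  \<open>(\<alpha>\<^bsub>k+1\<^esub> - \<alpha>\<^sub>0) exp(\<omega>\<^bsub>k+1\<^esub>) = K (\<alpha>\<^sub>p - \<alpha>\<^sub>k) exp(\<omega>\<^sub>k)\<close>, which is the recurrence of binomial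
  weights; \<open>\<alpha>\<^sub>p - \<alpha>\<^sub>0 = p\<mu>\<close> forces \<open>c = 2/p\<close>.
\<close>

section \<open>Scalar curvature of a conformally flat metric on the plane\<close>

lemma matrix_inv_mat:
  fixes c :: real
  assumes "c \<noteq> 0"
  shows "matrix_inv (mat c :: real^'n^'n) = mat (1 / c)"
proof -
  have *: "mat a ** mat b = (mat (a * b) :: real^'n^'n)" for a b :: real
    by (simp add: matrix_matrix_mult_def mat_def vec_eq_iff mult_delta_left)
  let ?A = "mat c :: real^'n^'n" and ?B = "mat (1 / c) :: real^'n^'n"
  have "?A ** ?B = mat 1 \<and> ?B ** ?A = mat 1"
    using assms by (simp add: *)
  \<comment> \<open>\<open>matrix_inv\<close> chooses some two-sided inverse. Since
    \<open>?B\<close> is one, the chosen matrix is one too, and multiplying by \<open>?B\<close>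
    from the left identifies it.\<close>
  then have "?A ** matrix_inv ?A = mat 1 \<and> matrix_inv ?A ** ?A = mat 1"
    unfolding matrix_inv_def by (rule someI)
  then have "?B ** (?A ** matrix_inv ?A) = ?B"
    by simp
  then show ?thesis
    unfolding matrix_mul_assoc * using assms by simp
qed

lemma partial_comp_fst_coordinate:
  fixes f :: "real \<Rightarrow> real" and u :: "real^2"
  assumes "(f has_real_derivative D) (at (u $ 1))"
  shows "partial i (\<lambda>y. f (y $ 1)) u = (if i = 1 then D else 0)"
proof (cases "i = 1")
  case True
  have "((\<lambda>t. f (t + u $ 1)) has_real_derivative D) (at 0)"
    using assms DERIV_shift[of f D 0 "u $ 1"] by simp
  then have "((\<lambda>t. f (u $ 1 + t)) has_real_derivative D) (at 0)"
    by (simp add: add.commute)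
  then show ?thesis
    using True by (simp add: partial_def axis_def DERIV_imp_deriv)
next
  case False
  then show ?thesis
    by (simp add: partial_def axis_def)
qed

text \<open>The Christoffel symbols are constants times (ln h)'/2, their quadratic contributions
  cancel, and -(ln h)''/h remains; the right-hand side is this with the logarithm differentiated
  out.\<close>

lemma scalar_curvature_conformal:
  fixes h h' h'' :: "real \<Rightarrow> real" and u :: "real^2"
  assumes pos: "\<And>q. h q > 0"
    and h': "\<And>q. (h has_real_derivative h' q) (at q)"
    and h'': "\<And>q. (h' has_real_derivative h'' q) (at q)"
  shows "scalar_curvature (\<lambda>u. mat (h (u $ 1))) u
    = ((h' (u $ 1))\<^sup>2 - h (u $ 1) * h'' (u $ 1)) / h (u $ 1) ^ 3"
proof -
  let ?g = "\<lambda>u::real^2. mat (h (u $ 1)) :: real^2^2"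
  define G where "G q = h' q / (2 * h q)" for q
  define G' where "G' q = (h'' q * h q - (h' q)\<^sup>2) / (2 * (h q)\<^sup>2)" for q
  \<comment> \<open>The Christoffel symbols are \<open>s k i j * (h' / (2 * h))\<close> with \<open>s\<close> constant.\<close>
  define s :: "2 \<Rightarrow> 2 \<Rightarrow> 2 \<Rightarrow> real" where
    "s k i j = (if j = k \<and> i = 1 then 1 else 0) + (if i = k \<and> j = 1 then 1 else 0)
       - (if i = j \<and> k = 1 then 1 else 0)" for k i j
  have nz: "h q \<noteq> 0" for q
    using pos[of q] by simp
  have G': "(G has_real_derivative G' q) (at q)" for q
  proof -
    have "(G has_real_derivative (h'' q * (2 * h q) - h' q * (2 * h' q)) / (2 * h q * (2 * h q))) (at q)"
      unfolding G_def[abs_def] by (intro DERIV_divide DERIV_cmult h' h'') (use nz in simp)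
    moreover have "(a * (2 * b) - c * (2 * c)) / (2 * b * (2 * b)) = (a * b - c\<^sup>2) / (2 * b\<^sup>2)" for a b c :: real
      by (cases "b = 0") (simp_all add: divide_simps power2_eq_square)
    ultimately show ?thesis
      unfolding G'_def by simp
  qed
  have partial_g: "partial i (\<lambda>y. ?g y $ j $ l) x = (if i = 1 \<and> j = l then h' (x $ 1) else 0)" for i j l x
  proof (cases "j = l")
    case True
    then show ?thesis
      using partial_comp_fst_coordinate[OF h', of i x] by (simp add: mat_def)
  next
    case False
    then show ?thesis
      by (simp add: mat_def partial_def)
  qed
  have mat_nth: "(mat a :: real^2^2) $ i $ j = (if i = j then a else 0)" for a i j
    by (simp add: mat_def)
  have christoffel: "christoffel ?g k i j = (\<lambda>x. s k i j * G (x $ 1))" for k i j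
  proof
    fix x
    have "christoffel ?g k i j x = (\<Sum>l\<in>UNIV. if k = l then
        1 / h (x $ 1) * ((if i = 1 \<and> j = l then h' (x $ 1) else 0) + (if j = 1 \<and> i = l then h' (x $ 1) else 0)
         - (if l = 1 \<and> i = j then h' (x $ 1) else 0)) else 0) / 2"
      unfolding christoffel_def partial_g matrix_inv_mat[OF nz]
      by (intro arg_cong[where f = "\<lambda>y. y / 2"] sum.cong refl) (simp add: mat_nth)
    also have "\<dots> = s k i j * G (x $ 1)"
      by (simp add: s_def G_def)
    finally show "christoffel ?g k i j x = s k i j * G (x $ 1)" .
  qed
  have partial_ch: "partial i (christoffel ?g k j l) x = (if i = 1 then s k j l * G' (x $ 1) else 0)"
    for i k j l x
  proof -
    have "((\<lambda>q. s k j l * G q) has_real_derivative s k j l * G' (x $ 1)) (at (x $ 1))"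
      by (rule DERIV_cmult[OF G'])
    from partial_comp_fst_coordinate[OF this, of i] show ?thesis
      by (simp add: christoffel)
  qed
  \<comment> \<open>Both diagonal Ricci components equal \<open>- G'\<close>, and the inverse metric
    contributes a factor 1/h to each.\<close>
  have "scalar_curvature ?g u = - 2 * G' (u $ 1) / h (u $ 1)"
    unfolding scalar_curvature_def ricci_def riemann_def partial_ch matrix_inv_mat[OF nz]
    by (simp add: sum_2 s_def mat_nth christoffel)
  also have "\<dots> = - (h'' (u $ 1) * h (u $ 1) - (h' (u $ 1))\<^sup>2) / h (u $ 1) ^ 3"
  proof -
    have "- 2 * (N / (2 * a\<^sup>2)) / a = - N / a ^ 3" for N a :: real
      by (simp add: power2_eq_square power3_eq_cube)
    then show ?thesis
      unfolding G'_def .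
  qed
  finally show ?thesis
    by (simp only: minus_diff_eq mult.commute)
qed

section \<open>Linear independence of exponentials\<close>

text \<open>After division by the exponential with the largest exponent, every other term
  decays.\<close>

lemma exp_sum_dominant_term_at_top:
  fixes c x :: "'i \<Rightarrow> real"
  assumes fin: "finite I" and i0: "i0 \<in> I" and dom: "\<And>i. i \<in> I \<Longrightarrow> i \<noteq> i0 \<Longrightarrow> x i < x i0"
  shows "((\<lambda>t. exp (- (t * x i0)) * (\<Sum>i\<in>I. c i * exp (t * x i))) \<longlongrightarrow> c i0) at_top"
proof -
  have "((\<lambda>t. \<Sum>i\<in>I. c i * exp (t * (x i - x i0))) \<longlongrightarrow> (\<Sum>i\<in>I. if i = i0 then c i else 0)) at_top"
  proof (rule tendsto_sum)
    fix i assume i: "i \<in> I"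
    show "((\<lambda>t. c i * exp (t * (x i - x i0))) \<longlongrightarrow> (if i = i0 then c i else 0)) at_top"
    proof (cases "i = i0")
      case False
      have "filterlim (\<lambda>t. (x i - x i0) * t) at_bot at_top"
        using dom[OF i False]
        by (intro filterlim_tendsto_neg_mult_at_bot[OF tendsto_const]) (auto simp: filterlim_ident)
      then have "((\<lambda>t. exp ((x i - x i0) * t)) \<longlongrightarrow> 0) at_top"
        by (rule filterlim_compose[OF exp_at_bot])
      from tendsto_mult_right_zero[OF this, of "c i"] False show ?thesis
        by (simp add: mult.commute)
    qed simp
  qed
  moreover have "exp (- (t * x i0)) * (\<Sum>i\<in>I. c i * exp (t * x i)) = (\<Sum>i\<in>I. c i * exp (t * (x i - x i0)))" for t
    by (simp add: sum_distrib_left algebra_simps flip: exp_add)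
  ultimately show ?thesis
    using fin i0 by simp
qed

text \<open>Growth at infinity isolates the coefficient of the largest exponent; once it vanishes,
  that term drops out. Hence the induction that inserts exponents in increasing order.\<close>

lemma exp_sum_eq_0_imp_coeff_eq_0:
  fixes c :: "real \<Rightarrow> real"
  assumes "finite S" and "\<And>t. (\<Sum>a\<in>S. c a * exp (t * a)) = 0" and "a \<in> S"
  shows "c a = 0"
  using assms
proof (induction S arbitrary: a rule: finite_linorder_max_induct)
  case empty
  then show ?case by simp
next
  case (insert b S)
  have "((\<lambda>t. exp (- (t * b)) * (\<Sum>a\<in>insert b S. c a * exp (t * a))) \<longlongrightarrow> c b) at_top"
    by (rule exp_sum_dominant_term_at_top[where x = "\<lambda>a. a"]) (use insert in auto)
  then have b: "c b = 0"
    using insert.prems(1) by (simp add: tendsto_const_iff)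
  have "(\<Sum>a\<in>S. c a * exp (t * a)) = 0" for t
    using insert.prems(1)[of t] insert.hyps b by (subst (asm) sum.insert) auto
  with insert.IH insert.prems(2) b show ?case
    by auto
qed

text \<open>With all coefficients nonzero, independence forces the same set of exponents on both
  sides, and increasing enumerations of one set agree term by term.\<close>

lemma exp_sum_eq_imp_exponents_coeffs_eq:
  fixes a b x y :: "nat \<Rightarrow> real"
  assumes x: "strict_mono_on {..<n} x" and y: "strict_mono_on {..<n} y"
    and a: "\<And>k. k < n \<Longrightarrow> a k \<noteq> 0" and b: "\<And>k. k < n \<Longrightarrow> b k \<noteq> 0"
    and eq: "\<And>t. (\<Sum>k<n. a k * exp (t * x k)) = (\<Sum>k<n. b k * exp (t * y k))"
    and k: "k < n"
  shows "x k = y k" and "a k = b k"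
proof -
  \<comment> \<open>The coefficient of \<open>exp (t * v)\<close> in each sum: an empty sum, hence
    0, when \<open>v\<close> is not among its exponents.\<close>
  define A where "A v = (\<Sum>k | k < n \<and> x k = v. a k)" for v
  define B where "B v = (\<Sum>k | k < n \<and> y k = v. b k)" for v
  let ?S = "x ` {..<n} \<union> y ` {..<n}"
  have group: "(\<Sum>v\<in>?S. (\<Sum>k | k < n \<and> z k = v. c k) * exp (t * v)) = (\<Sum>k<n. c k * exp (t * z k))"
    if "z ` {..<n} \<subseteq> ?S" for z c :: "nat \<Rightarrow> real" and t
  proof -
    have "(\<Sum>k<n. c k * exp (t * z k)) = (\<Sum>v\<in>?S. \<Sum>k | k \<in> {..<n} \<and> z k = v. c k * exp (t * z k))"
      using that by (intro sum.group[symmetric]) auto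
    also have "\<dots> = (\<Sum>v\<in>?S. (\<Sum>k | k < n \<and> z k = v. c k) * exp (t * v))"
      by (intro sum.cong refl) (simp add: sum_distrib_right)
    finally show ?thesis ..
  qed
  have "(\<Sum>v\<in>?S. (A v - B v) * exp (t * v)) = 0" for t
    using group[of x a t] group[of y b t] eq[of t]
    by (simp add: left_diff_distrib sum_subtractf A_def B_def)
  then have AB: "A v = B v" if "v \<in> ?S" for v
    using exp_sum_eq_0_imp_coeff_eq_0[of ?S "\<lambda>v. A v - B v" v] that by simp
  have single: "{k. k < n \<and> z k = z j} = {j}" if "strict_mono_on {..<n} z" "j < n"
    for z :: "nat \<Rightarrow> real" and j
    using strict_mono_on_imp_inj_on[OF that(1)] that(2) by (auto dest: inj_onD)
  have A: "A (x j) = a j" if "j < n" for j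
    using single[OF x that] by (simp add: A_def)
  have B: "B (y j) = b j" if "j < n" for j
    using single[OF y that] by (simp add: B_def)
  have "x ` {..<n} = y ` {..<n}"
  proof (intro equalityI subsetI)
    fix v assume v: "v \<in> x ` {..<n}"
    then have "B v \<noteq> 0" using A a AB[of v] by auto
    then show "v \<in> y ` {..<n}"
      unfolding B_def by (cases "{k. k < n \<and> y k = v} = {}") auto
  next
    fix v assume v: "v \<in> y ` {..<n}"
    then have "A v \<noteq> 0" using B b AB[of v] by auto
    then show "v \<in> x ` {..<n}"
      unfolding A_def by (cases "{k. k < n \<and> x k = v} = {}") auto
  qed
  moreover have "sorted (map z [0..<n]) \<and> distinct (map z [0..<n])"
    if "strict_mono_on {..<n} z" for z :: "nat \<Rightarrow> real"
    using strict_mono_on_imp_inj_on[OF that] that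
    by (auto simp: sorted_iff_nth_mono distinct_map atLeast0LessThan
        intro: strict_mono_on_leD)
  ultimately have "map x [0..<n] = map y [0..<n]"
    using x y by (intro sorted_distinct_set_unique) (auto simp: atLeast0LessThan)
  then show xy: "x k = y k"
    using k by simp
  show "a k = b k"
    using A[OF k] B[OF k] AB[of "x k"] k xy by simp
qed

section \<open>Finite exponential sums\<close>

locale exponential_sum =
  fixes p :: nat and \<alpha> \<omega> :: "nat \<Rightarrow> real"
  assumes p_pos: "p > 0" and \<alpha>_mono: "strict_mono_on {0..p} \<alpha>"
begin

text \<open>Not normalised: \<open>moment 0\<close> is the partition function Z, and differentiation
  raises the index by one.\<close>

definition moment :: "nat \<Rightarrow> real \<Rightarrow> real" where
  "moment j \<theta> = (\<Sum>k\<le>p. \<alpha> k ^ j * exp (\<omega> k) * exp (\<theta> * \<alpha> k))"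

definition mean :: "real \<Rightarrow> real" where
  "mean \<theta> = moment 1 \<theta> / moment 0 \<theta>"

definition variance :: "real \<Rightarrow> real" where
  "variance \<theta> = moment 2 \<theta> / moment 0 \<theta> - (mean \<theta>)\<^sup>2"

text \<open>The third derivative of ln Z, arranged as the quotient rule delivers it from
  \<open>variance\<close>.\<close>

definition third_cumulant :: "real \<Rightarrow> real" where
  "third_cumulant \<theta> = moment 3 \<theta> / moment 0 \<theta> - moment 2 \<theta> * moment 1 \<theta> / (moment 0 \<theta>)\<^sup>2
     - 2 * mean \<theta> * variance \<theta>"

section \<open>Derivatives of the cumulants and positivity of the variance\<close>

lemma \<alpha>_less: "i < j \<Longrightarrow> j \<le> p \<Longrightarrow> \<alpha> i < \<alpha> j"
  using \<alpha>_mono by (auto simp: strict_mono_on_def)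

lemma \<alpha>_le: "i \<le> j \<Longrightarrow> j \<le> p \<Longrightarrow> \<alpha> i \<le> \<alpha> j"
  using \<alpha>_less[of i j] by (cases "i = j") auto

lemma DERIV_moment: "(moment j has_real_derivative moment (Suc j) \<theta>) (at \<theta>)"
  unfolding moment_def by (auto intro!: derivative_eq_intros sum.cong)

lemma moment_0_pos: "moment 0 \<theta> > 0"
  unfolding moment_def by (rule sum_pos) auto

lemma moment_0_nz [simp]: "moment 0 \<theta> \<noteq> 0"
  using moment_0_pos[of \<theta>] by simp

lemma DERIV_mean: "(mean has_real_derivative variance \<theta>) (at \<theta>)"
  unfolding mean_def[abs_def] variance_def
  by (rule derivative_eq_intros DERIV_moment refl moment_0_nz)+
    (simp add: field_simps power2_eq_square eval_nat_numeral)

lemma DERIV_variance: "(variance has_real_derivative third_cumulant \<theta>) (at \<theta>)"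
  unfolding variance_def[abs_def] third_cumulant_def
  by (rule derivative_eq_intros DERIV_moment DERIV_mean refl moment_0_nz)+
    (simp add: field_simps power2_eq_square eval_nat_numeral variance_def)

text \<open>Makes \<open>deriv third_cumulant\<close> a genuine derivative, which then stands in for
  an explicit fourth cumulant.\<close>

lemma third_cumulant_differentiable: "\<exists>D. (third_cumulant has_real_derivative D) (at \<theta>)"
  unfolding third_cumulant_def[abs_def]
  by (rule exI, (rule derivative_eq_intros DERIV_moment DERIV_mean DERIV_variance refl moment_0_nz | simp)+)

text \<open>Expanding the square gives this. It yields strict positivity of the variance and, later,
  its equality with the Fisher metric.\<close>

lemma sum_weighted_diff_sq:
  "(\<Sum>k\<le>p. (\<alpha> k - mean \<theta>)\<^sup>2 * exp (\<omega> k) * exp (\<theta> * \<alpha> k)) = moment 0 \<theta> * variance \<theta>"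
proof -
  let ?m = "mean \<theta>"
  have "(\<Sum>k\<le>p. (\<alpha> k - ?m)\<^sup>2 * exp (\<omega> k) * exp (\<theta> * \<alpha> k))
      = moment 2 \<theta> - 2 * ?m * moment 1 \<theta> + ?m\<^sup>2 * moment 0 \<theta>"
    unfolding moment_def sum_distrib_left sum_subtractf[symmetric] sum.distrib[symmetric]
    by (intro sum.cong refl) (simp add: power2_eq_square algebra_simps)
  also have "moment 1 \<theta> = ?m * moment 0 \<theta>"
    by (simp add: mean_def)
  also have "moment 2 \<theta> = (variance \<theta> + ?m\<^sup>2) * moment 0 \<theta>"
    by (simp add: variance_def)
  finally show ?thesis
    by (simp add: algebra_simps power2_eq_square)
qed

lemma variance_pos: "variance \<theta> > 0"
proof -
  have "0 < (\<Sum>k\<le>p. (\<alpha> k - mean \<theta>)\<^sup>2 * exp (\<omega> k) * exp (\<theta> * \<alpha> k))"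
  proof -
    \<comment> \<open>The mean cannot equal both \<open>\<alpha> 0\<close> and
      \<open>\<alpha> p\<close>, which differ because \<open>p > 0\<close>.\<close>
    obtain k where "k \<le> p" "\<alpha> k \<noteq> mean \<theta>"
      using \<alpha>_less[OF p_pos] by (metis le0 order_refl less_irrefl)
    then show ?thesis
      by (intro sum_pos2[of _ k]) auto
  qed
  then show ?thesis
    using moment_0_pos[of \<theta>] by (simp add: sum_weighted_diff_sq zero_less_mult_iff)
qed

section \<open>Range of the mean, and limits of mean and variance\<close>

lemma mean_diff_left:
  "(mean \<theta> - \<alpha> 0) * moment 0 \<theta> = (\<Sum>k\<le>p. (\<alpha> k - \<alpha> 0) * exp (\<omega> k) * exp (\<theta> * \<alpha> k))"
proof -
  have "(mean \<theta> - \<alpha> 0) * moment 0 \<theta> = moment 1 \<theta> - \<alpha> 0 * moment 0 \<theta>"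
    by (simp add: mean_def field_simps)
  then show ?thesis
    by (simp add: moment_def sum_distrib_left sum_subtractf algebra_simps)
qed

lemma mean_diff_right:
  "(\<alpha> p - mean \<theta>) * moment 0 \<theta> = (\<Sum>k\<le>p. (\<alpha> p - \<alpha> k) * exp (\<omega> k) * exp (\<theta> * \<alpha> k))"
proof -
  have "(\<alpha> p - mean \<theta>) * moment 0 \<theta> = \<alpha> p * moment 0 \<theta> - moment 1 \<theta>"
    by (simp add: mean_def field_simps)
  then show ?thesis
    by (simp add: moment_def sum_distrib_left sum_subtractf algebra_simps)
qed

lemma mean_greater: "\<alpha> 0 < mean \<theta>"
proof -
  have "0 < (mean \<theta> - \<alpha> 0) * moment 0 \<theta>"
    unfolding mean_diff_left
    by (rule sum_pos2[of _ p]) (use \<alpha>_less[OF p_pos] \<alpha>_le in auto)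
  then show ?thesis
    using moment_0_pos[of \<theta>] by (simp add: zero_less_mult_iff)
qed

lemma mean_less: "mean \<theta> < \<alpha> p"
proof -
  have "0 < (\<alpha> p - mean \<theta>) * moment 0 \<theta>"
    unfolding mean_diff_right
    by (rule sum_pos2[of _ 0]) (use \<alpha>_less[OF p_pos] \<alpha>_le in auto)
  then show ?thesis
    using moment_0_pos[of \<theta>] by (simp add: zero_less_mult_iff)
qed

lemma moment_ratio_at_top: "((\<lambda>\<theta>. moment j \<theta> / moment 0 \<theta>) \<longlongrightarrow> \<alpha> p ^ j) at_top"
proof -
  have "((\<lambda>\<theta>. exp (- (\<theta> * \<alpha> p)) * moment j \<theta>) \<longlongrightarrow> \<alpha> p ^ j * exp (\<omega> p)) at_top" for j
    unfolding moment_def by (rule exp_sum_dominant_term_at_top) (use \<alpha>_less in auto)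
  from tendsto_divide[OF this[of j] this[of 0]] show ?thesis
    by simp
qed

text \<open>Replacing the parameter by its negative makes the smallest exponent dominant, so the
  limit at plus infinity applies.\<close>

lemma moment_ratio_at_bot: "((\<lambda>\<theta>. moment j \<theta> / moment 0 \<theta>) \<longlongrightarrow> \<alpha> 0 ^ j) at_bot"
proof -
  have "((\<lambda>t. exp (- (t * - \<alpha> 0)) * moment j (- t)) \<longlongrightarrow> \<alpha> 0 ^ j * exp (\<omega> 0)) at_top" for j
    using exp_sum_dominant_term_at_top[of "{..p}" 0 "\<lambda>k. - \<alpha> k" "\<lambda>k. \<alpha> k ^ j * exp (\<omega> k)"] \<alpha>_less
    by (simp add: moment_def)
  from tendsto_divide[OF this[of j] this[of 0]] show ?thesis
    by (simp add: filterlim_at_bot_mirror)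
qed

lemma mean_at_top: "(mean \<longlongrightarrow> \<alpha> p) at_top" and mean_at_bot: "(mean \<longlongrightarrow> \<alpha> 0) at_bot"
  using moment_ratio_at_top[of 1] moment_ratio_at_bot[of 1] by (simp_all add: mean_def[abs_def])

text \<open>At either end the distribution concentrates on a single value.\<close>

lemma variance_at_top: "(variance \<longlongrightarrow> 0) at_top" and variance_at_bot: "(variance \<longlongrightarrow> 0) at_bot"
  using tendsto_diff[OF moment_ratio_at_top[of 2] tendsto_power[OF mean_at_top, of 2]]
    tendsto_diff[OF moment_ratio_at_bot[of 2] tendsto_power[OF mean_at_bot, of 2]]
  by (simp_all add: variance_def[abs_def])

section \<open>Constant curvature, quadratic variance and the logistic equation\<close>

text \<open>The expression -(ln h)''/h with h the variance.\<close>

definition curvature :: "real \<Rightarrow> real" where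
  "curvature \<theta> = ((third_cumulant \<theta>)\<^sup>2 - variance \<theta> * deriv third_cumulant \<theta>) / variance \<theta> ^ 3"

lemma DERIV_third_cumulant:
  "(third_cumulant has_real_derivative deriv third_cumulant \<theta>) (at \<theta>)"
  using third_cumulant_differentiable DERIV_imp_deriv by blast

text \<open>If h = Q(m) with Q'' = -c, then h' = Q'(m) h and h'' = -c h^2 + Q'(m) h', so h'^2 - h
  h'' = c h^3.\<close>

lemma curvature_eq_if_variance_quadratic:
  assumes "\<And>\<theta>. variance \<theta> = c / 2 * (mean \<theta> - \<alpha> 0) * (\<alpha> p - mean \<theta>)"
  shows "curvature \<theta> = c"
proof -
  define Q' where "Q' \<theta> = c / 2 * (\<alpha> 0 + \<alpha> p - 2 * mean \<theta>)" for \<theta>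
  have "((\<lambda>\<theta>. c / 2 * (mean \<theta> - \<alpha> 0) * (\<alpha> p - mean \<theta>)) has_real_derivative Q' \<theta> * variance \<theta>) (at \<theta>)" for \<theta>
    by (rule derivative_eq_intros DERIV_mean refl)+ (simp add: Q'_def field_simps)
  then have "(variance has_real_derivative Q' \<theta> * variance \<theta>) (at \<theta>)" for \<theta>
    using assms by (metis (no_types, lifting) ext)
  then have third: "third_cumulant = (\<lambda>\<theta>. Q' \<theta> * variance \<theta>)"
    using DERIV_unique[OF DERIV_variance] by auto
  have "((\<lambda>\<theta>. Q' \<theta> * variance \<theta>) has_real_derivative - c * variance \<theta> * variance \<theta> + Q' \<theta> * third_cumulant \<theta>) (at \<theta>)"
    unfolding Q'_def
    by (rule derivative_eq_intros DERIV_mean DERIV_variance refl)+ (simp add: algebra_simps)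
  then have D: "deriv third_cumulant \<theta> = - c * variance \<theta> * variance \<theta> + Q' \<theta> * third_cumulant \<theta>"
    unfolding third by (rule DERIV_imp_deriv)
  have "third_cumulant \<theta> = Q' \<theta> * variance \<theta>"
    by (simp add: third)
  then have "(third_cumulant \<theta>)\<^sup>2 - variance \<theta> * deriv third_cumulant \<theta> = c * variance \<theta> ^ 3"
    unfolding D by (simp add: algebra_simps power2_eq_square power3_eq_cube)
  then show ?thesis
    unfolding curvature_def using variance_pos[of \<theta>] by simp
qed

text \<open>Since (ln h)'' = -c m', one integration gives h' = (a - c m) h. As h = m', a second
  gives h = a m - (c/2) m^2 + e, and the limits at both ends fix \<open>a\<close> and
  \<open>e\<close>.\<close>

lemma variance_quadratic_if_curvature_eq:
  assumes "\<And>\<theta>. curvature \<theta> = c"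
  shows "variance \<theta> = c / 2 * (mean \<theta> - \<alpha> 0) * (\<alpha> p - mean \<theta>)"
proof -
  have nz: "variance \<theta> \<noteq> 0" for \<theta>
    using variance_pos[of \<theta>] by simp
  have "((\<lambda>\<theta>. third_cumulant \<theta> / variance \<theta> + c * mean \<theta>) has_real_derivative 0) (at \<theta>)" for \<theta>
  proof -
    have "c * variance \<theta> ^ 3 = (third_cumulant \<theta>)\<^sup>2 - variance \<theta> * deriv third_cumulant \<theta>"
      using assms[of \<theta>] nz[of \<theta>] by (auto simp: curvature_def field_simps)
    then have "(deriv third_cumulant \<theta> * variance \<theta> - third_cumulant \<theta> * third_cumulant \<theta>)
        / (variance \<theta> * variance \<theta>) + c * variance \<theta> = 0"
      using nz[of \<theta>] by (simp add: field_simps power2_eq_square power3_eq_cube)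
    moreover have "((\<lambda>\<theta>. third_cumulant \<theta> / variance \<theta> + c * mean \<theta>) has_real_derivative
        (deriv third_cumulant \<theta> * variance \<theta> - third_cumulant \<theta> * third_cumulant \<theta>)
          / (variance \<theta> * variance \<theta>) + c * variance \<theta>) (at \<theta>)"
      by (intro DERIV_add DERIV_divide DERIV_cmult DERIV_mean DERIV_variance DERIV_third_cumulant nz)
    ultimately show ?thesis
      by simp
  qed
  then have "\<forall>\<theta>. ((\<lambda>\<theta>. third_cumulant \<theta> / variance \<theta> + c * mean \<theta>) has_real_derivative 0) (at \<theta>)"
    by blast
  then obtain a where a: "third_cumulant \<theta> / variance \<theta> + c * mean \<theta> = a" for \<theta>
    using DERIV_isconst_all by blast
  have third: "third_cumulant \<theta> = (a - c * mean \<theta>) * variance \<theta>" for \<theta>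
    using a[of \<theta>] nz[of \<theta>] by (simp add: field_simps)
  have "\<forall>\<theta>. ((\<lambda>\<theta>. variance \<theta> - a * mean \<theta> + c / 2 * (mean \<theta>)\<^sup>2) has_real_derivative 0) (at \<theta>)"
    by (intro allI, (rule derivative_eq_intros DERIV_mean DERIV_variance refl)+)
      (simp add: third algebra_simps)
  then obtain e where e: "variance \<theta> - a * mean \<theta> + c / 2 * (mean \<theta>)\<^sup>2 = e" for \<theta>
    using DERIV_isconst_all[of "\<lambda>\<theta>. variance \<theta> - a * mean \<theta> + c / 2 * (mean \<theta>)\<^sup>2"] by blast
  \<comment> \<open>A constant function equals its limit; used at both ends of the line.\<close>
  have lim: "0 - a * x + c / 2 * x\<^sup>2 = e"
    if "(mean \<longlongrightarrow> x) F" "(variance \<longlongrightarrow> 0) F" "F \<noteq> bot" for x F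
  proof -
    have "((\<lambda>\<theta>. variance \<theta> - a * mean \<theta> + c / 2 * (mean \<theta>)\<^sup>2) \<longlongrightarrow> 0 - a * x + c / 2 * x\<^sup>2) F"
      by (intro tendsto_intros that)
    then show ?thesis
      using that(3) unfolding e by (simp add: tendsto_const_iff)
  qed
  have top: "- a * \<alpha> p + c / 2 * (\<alpha> p)\<^sup>2 = e" and bot: "- a * \<alpha> 0 + c / 2 * (\<alpha> 0)\<^sup>2 = e"
    using lim[OF mean_at_top variance_at_top] lim[OF mean_at_bot variance_at_bot] by simp_all
  \<comment> \<open>Subtracting the two boundary equations eliminates \<open>e\<close>.\<close>
  have "(\<alpha> p - \<alpha> 0) * (c / 2 * (\<alpha> p + \<alpha> 0) - a) = 0"
  proof -
    have "(x - y) * (c / 2 * (x + y) - a) = (- a * x + c / 2 * x\<^sup>2) - (- a * y + c / 2 * y\<^sup>2)" for x y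
      by (simp add: field_simps power2_eq_square)
    then show ?thesis
      using top bot by simp
  qed
  then have a_eq: "a = c / 2 * (\<alpha> p + \<alpha> 0)"
    using \<alpha>_less[of 0 p] p_pos by simp
  \<comment> \<open>The quadratic with roots \<open>y\<close> and \<open>x\<close>; its constant
    term is written so as to match \<open>bot\<close>.\<close>
  have "c / 2 * (m - y) * (x - m) = c / 2 * (x + y) * m - c / 2 * m\<^sup>2 + (- (c / 2 * (x + y)) * y + c / 2 * y\<^sup>2)"
    for m x y
    by (simp add: field_simps power2_eq_square)
  then show ?thesis
    using e[of \<theta>] bot unfolding a_eq by simp
qed

text \<open>For the odds y = (m - \<alpha>_0)/(\<alpha>_p - m), the logistic equation becomes the
  linear equation y' = \<mu> y.\<close>

lemma variance_quadratic_iff_mean_odds_exponential: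
  "(\<forall>\<theta>. variance \<theta> = l * (mean \<theta> - \<alpha> 0) * (\<alpha> p - mean \<theta>))
   \<longleftrightarrow> (\<exists>K>0. \<forall>\<theta>. mean \<theta> - \<alpha> 0 = K * exp (l * (\<alpha> p - \<alpha> 0) * \<theta>) * (\<alpha> p - mean \<theta>))"
proof
  define y where "y \<theta> = (mean \<theta> - \<alpha> 0) / (\<alpha> p - mean \<theta>)" for \<theta>
  let ?\<mu> = "l * (\<alpha> p - \<alpha> 0)"
  have right: "\<alpha> p - mean \<theta> \<noteq> 0" for \<theta>
    using mean_less[of \<theta>] by simp
  assume v: "\<forall>\<theta>. variance \<theta> = l * (mean \<theta> - \<alpha> 0) * (\<alpha> p - mean \<theta>)"
  \<comment> \<open>The integrating factor makes this product constant.\<close>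
  have "\<forall>\<theta>. ((\<lambda>\<theta>. y \<theta> * exp (- ?\<mu> * \<theta>)) has_real_derivative 0) (at \<theta>)"
  proof
    fix \<theta>
    have "(y has_real_derivative variance \<theta> * (\<alpha> p - \<alpha> 0) / (\<alpha> p - mean \<theta>)\<^sup>2) (at \<theta>)"
      unfolding y_def[abs_def]
      by (rule derivative_eq_intros DERIV_mean refl right)+ (use right[of \<theta>] in \<open>simp add: field_simps power2_eq_square\<close>)
    moreover have "variance \<theta> * (\<alpha> p - \<alpha> 0) / (\<alpha> p - mean \<theta>)\<^sup>2 = ?\<mu> * y \<theta>"
      using right[of \<theta>] by (simp add: y_def v[rule_format, of \<theta>] power2_eq_square)
    ultimately have y': "(y has_real_derivative ?\<mu> * y \<theta>) (at \<theta>)"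
      by simp
    show "((\<lambda>\<theta>. y \<theta> * exp (- ?\<mu> * \<theta>)) has_real_derivative 0) (at \<theta>)"
      by (rule derivative_eq_intros y' refl)+ (simp add: algebra_simps)
  qed
  then have "y \<theta> * exp (- ?\<mu> * \<theta>) = y 0" for \<theta>
    using DERIV_isconst_all[of "\<lambda>\<theta>. y \<theta> * exp (- ?\<mu> * \<theta>)" \<theta> 0] by simp
  moreover have "y \<theta> = y \<theta> * exp (- ?\<mu> * \<theta>) * exp (?\<mu> * \<theta>)" for \<theta>
    by (simp add: mult.assoc flip: exp_add)
  ultimately have "y \<theta> = y 0 * exp (?\<mu> * \<theta>)" for \<theta>
    by metis
  then have "mean \<theta> - \<alpha> 0 = y 0 * exp (?\<mu> * \<theta>) * (\<alpha> p - mean \<theta>)" for \<theta>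
    using right[of \<theta>] y_def[of \<theta>] by (metis nonzero_eq_divide_eq)
  moreover have "y 0 > 0"
    using mean_less[of 0] mean_greater[of 0] by (simp add: y_def)
  ultimately show "\<exists>K>0. \<forall>\<theta>. mean \<theta> - \<alpha> 0 = K * exp (?\<mu> * \<theta>) * (\<alpha> p - mean \<theta>)"
    by blast
next
  let ?\<mu> = "l * (\<alpha> p - \<alpha> 0)"
  assume "\<exists>K>0. \<forall>\<theta>. mean \<theta> - \<alpha> 0 = K * exp (?\<mu> * \<theta>) * (\<alpha> p - mean \<theta>)"
  then obtain K where "K > 0" and K: "mean \<theta> - \<alpha> 0 = K * exp (?\<mu> * \<theta>) * (\<alpha> p - mean \<theta>)" for \<theta>
    by blast
  show "\<forall>\<theta>. variance \<theta> = l * (mean \<theta> - \<alpha> 0) * (\<alpha> p - mean \<theta>)"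
  proof
    fix \<theta>
    let ?y = "K * exp (?\<mu> * \<theta>)"
    \<comment> \<open>Differentiating both sides of \<open>K\<close> gives a linear equation for the
      variance.\<close>
    have "((\<lambda>\<theta>. K * exp (?\<mu> * \<theta>) * (\<alpha> p - mean \<theta>)) has_real_derivative
        ?\<mu> * (?y * (\<alpha> p - mean \<theta>)) - ?y * variance \<theta>) (at \<theta>)"
      by (rule derivative_eq_intros DERIV_mean refl)+ (simp add: algebra_simps)
    moreover have "((\<lambda>\<theta>. K * exp (?\<mu> * \<theta>) * (\<alpha> p - mean \<theta>)) has_real_derivative variance \<theta>) (at \<theta>)"
      unfolding K[symmetric] by (rule derivative_eq_intros DERIV_mean refl)+ simp
    ultimately have "variance \<theta> = ?\<mu> * (?y * (\<alpha> p - mean \<theta>)) - ?y * variance \<theta>"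
      by (rule DERIV_unique[symmetric])
    then have "variance \<theta> = ?\<mu> * (mean \<theta> - \<alpha> 0) - ?y * variance \<theta>"
      unfolding K[of \<theta>] .
    moreover have "variance \<theta> * (1 + ?y) = variance \<theta> + ?y * variance \<theta>"
      by (simp only: ring_distribs mult_1_right mult.commute)
    ultimately have "variance \<theta> * (1 + ?y) = ?\<mu> * (mean \<theta> - \<alpha> 0)"
      by linarith
    \<comment> \<open>Multiplying by \<open>\<alpha> p - mean \<theta>\<close> turns the factor
      \<open>1 + ?y\<close> into \<open>\<alpha> p - \<alpha> 0\<close>, which cancels against the
      one in \<open>?\<mu>\<close>.\<close>
    moreover have "\<alpha> p - \<alpha> 0 = (1 + ?y) * (\<alpha> p - mean \<theta>)"
      using K[of \<theta>] by (simp add: distrib_right)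
    ultimately have "variance \<theta> * (\<alpha> p - \<alpha> 0) = ?\<mu> * (mean \<theta> - \<alpha> 0) * (\<alpha> p - mean \<theta>)"
      by (metis mult.assoc)
    then have "variance \<theta> * (\<alpha> p - \<alpha> 0) = l * (mean \<theta> - \<alpha> 0) * (\<alpha> p - mean \<theta>) * (\<alpha> p - \<alpha> 0)"
      by (simp only: mult_ac)
    then show "variance \<theta> = l * (mean \<theta> - \<alpha> 0) * (\<alpha> p - mean \<theta>)"
      using \<alpha>_less[of 0 p] p_pos by simp
  qed
qed

section \<open>Comparison of exponential sums\<close>

text \<open>Multiply by Z. The term k = 0 vanishes on the left and k = p on the right, so after
  shifting the left index both sums run over \<open>k < p\<close>.\<close>

lemma mean_odds_exponential_iff_exp_sum_eq:
  "mean \<theta> - \<alpha> 0 = K * exp (\<mu> * \<theta>) * (\<alpha> p - mean \<theta>)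
   \<longleftrightarrow> (\<Sum>k<p. (\<alpha> (Suc k) - \<alpha> 0) * exp (\<omega> (Suc k)) * exp (\<theta> * \<alpha> (Suc k)))
     = (\<Sum>k<p. K * (\<alpha> p - \<alpha> k) * exp (\<omega> k) * exp (\<theta> * (\<alpha> k + \<mu>)))"
proof -
  have "mean \<theta> - \<alpha> 0 = K * exp (\<mu> * \<theta>) * (\<alpha> p - mean \<theta>)
    \<longleftrightarrow> (mean \<theta> - \<alpha> 0) * moment 0 \<theta> = K * exp (\<mu> * \<theta>) * ((\<alpha> p - mean \<theta>) * moment 0 \<theta>)"
    using moment_0_nz by (simp flip: mult.assoc)
  moreover have "(\<Sum>k\<le>p. (\<alpha> k - \<alpha> 0) * exp (\<omega> k) * exp (\<theta> * \<alpha> k))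
      = (\<Sum>k<p. (\<alpha> (Suc k) - \<alpha> 0) * exp (\<omega> (Suc k)) * exp (\<theta> * \<alpha> (Suc k)))"
    by (simp add: sum.atMost_shift)
  moreover have "K * exp (\<mu> * \<theta>) * (\<Sum>k\<le>p. (\<alpha> p - \<alpha> k) * exp (\<omega> k) * exp (\<theta> * \<alpha> k))
      = (\<Sum>k<p. K * (\<alpha> p - \<alpha> k) * exp (\<omega> k) * exp (\<theta> * (\<alpha> k + \<mu>)))"
    by (simp add: lessThan_Suc_atMost[symmetric] sum_distrib_left ring_distribs(1) exp_add mult_ac)
  ultimately show ?thesis
    by (simp only: mean_diff_left mean_diff_right)
qed

text \<open>\<open>K > 0\<close> keeps every coefficient nonzero, so exponents and coefficients can
  be compared one by one.\<close>

lemma exp_sum_eq_iff_recurrence: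
  assumes "K > 0"
  shows "(\<forall>\<theta>. (\<Sum>k<p. (\<alpha> (Suc k) - \<alpha> 0) * exp (\<omega> (Suc k)) * exp (\<theta> * \<alpha> (Suc k)))
     = (\<Sum>k<p. K * (\<alpha> p - \<alpha> k) * exp (\<omega> k) * exp (\<theta> * (\<alpha> k + \<mu>))))
   \<longleftrightarrow> (\<forall>k<p. \<alpha> (Suc k) = \<alpha> k + \<mu> \<and>
          (\<alpha> (Suc k) - \<alpha> 0) * exp (\<omega> (Suc k)) = K * (\<alpha> p - \<alpha> k) * exp (\<omega> k))"
    (is "?L \<longleftrightarrow> ?R")
proof
  assume ?L
  have mono: "strict_mono_on {..<p} (\<lambda>k. \<alpha> (Suc k))" "strict_mono_on {..<p} (\<lambda>k. \<alpha> k + \<mu>)"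
    using \<alpha>_less by (auto simp: strict_mono_on_def)
  have nz: "(\<alpha> (Suc k) - \<alpha> 0) * exp (\<omega> (Suc k)) \<noteq> 0" "K * (\<alpha> p - \<alpha> k) * exp (\<omega> k) \<noteq> 0"
    if "k < p" for k
    using \<alpha>_less[of 0 "Suc k"] \<alpha>_less[of k p] assms that by auto
  show ?R
    using exp_sum_eq_imp_exponents_coeffs_eq[OF mono, of "\<lambda>k. (\<alpha> (Suc k) - \<alpha> 0) * exp (\<omega> (Suc k))"
        "\<lambda>k. K * (\<alpha> p - \<alpha> k) * exp (\<omega> k)"] nz \<open>?L\<close> by blast
next
  assume ?R
  then show ?L
    by (intro allI sum.cong refl) auto
qed

section \<open>Arithmetic progressions and binomial weights\<close>

lemma recurrence_imp_arithmetic: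
  assumes "\<And>k. k < p \<Longrightarrow> \<alpha> (Suc k) = \<alpha> k + \<mu>"
  shows "k \<le> p \<Longrightarrow> \<alpha> k = \<alpha> 0 + real k * \<mu>"
  by (induction k) (auto simp: assms algebra_simps)

lemma Suc_times_binomial_Suc: "real (Suc k) * real (n choose Suc k) = real (n - k) * real (n choose k)"
  using binomial_absorption[of k n] binomial_absorb_comp[of n k] by (metis of_nat_mult)

text \<open>Once \<mu> is cancelled, the weights z_k = exp(\<omega>_k) satisfy (k+1) z_{k+1} = K
  (p-k) z_k, the recurrence of K^k times the binomial coefficient; take logarithms.\<close>

lemma recurrence_imp_binomial:
  assumes "K > 0"
    and \<alpha>: "\<And>k. k < p \<Longrightarrow> \<alpha> (Suc k) = \<alpha> k + \<mu>"
    and \<omega>: "\<And>k. k < p \<Longrightarrow> (\<alpha> (Suc k) - \<alpha> 0) * exp (\<omega> (Suc k)) = K * (\<alpha> p - \<alpha> k) * exp (\<omega> k)"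
  shows "\<exists>r s. \<forall>k\<le>p. \<alpha> k = \<alpha> 0 + real k / real p * (\<alpha> p - \<alpha> 0) \<and>
    \<omega> k = r * real k + s * (real p - real k) + ln (real (p choose k))"
proof -
  have arith: "\<alpha> k = \<alpha> 0 + real k * \<mu>" if "k \<le> p" for k
    using recurrence_imp_arithmetic[OF \<alpha> that] .
  have \<mu>_pos: "\<mu> > 0"
    using \<alpha>[OF p_pos] \<alpha>_less[of 0 "Suc 0"] p_pos by simp
  have z: "exp (\<omega> k) = exp (\<omega> 0) * K ^ k * real (p choose k)" if "k \<le> p" for k
    using that
  proof (induction k)
    case (Suc k)
    then have "real (Suc k) * \<mu> * exp (\<omega> (Suc k)) = K * (real (p - k) * \<mu>) * exp (\<omega> k)"
      using \<omega>[of k] arith[of "Suc k"] arith[of k] arith[of p] by (simp add: of_nat_diff algebra_simps)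
    then have "\<mu> * (real (Suc k) * exp (\<omega> (Suc k))) = \<mu> * (real (p - k) * K * exp (\<omega> k))"
      by (simp only: mult_ac)
    then have "real (Suc k) * exp (\<omega> (Suc k)) = real (p - k) * K * exp (\<omega> k)"
      using \<mu>_pos by simp
    also have "\<dots> = exp (\<omega> 0) * K ^ Suc k * (real (p - k) * real (p choose k))"
      using Suc by simp
    also have "\<dots> = real (Suc k) * (exp (\<omega> 0) * K ^ Suc k * real (p choose Suc k))"
      unfolding Suc_times_binomial_Suc[symmetric] by (simp only: mult_ac)
    finally show ?case
      by (simp only: mult_cancel_left) simp
  qed simp
  show ?thesis
  proof (intro exI allI impI conjI)
    fix k assume k: "k \<le> p"
    show "\<alpha> k = \<alpha> 0 + real k / real p * (\<alpha> p - \<alpha> 0)"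
      using arith[OF k] arith[of p] p_pos by simp
    have "\<omega> k = ln (exp (\<omega> 0) * K ^ k * real (p choose k))"
      using z[OF k] by (metis ln_exp)
    also have "\<dots> = \<omega> 0 + real k * ln K + ln (real (p choose k))"
      using \<open>K > 0\<close> k by (simp add: ln_mult ln_realpow)
    \<comment> \<open>Spreading the constant over k and p - k produces the required form, with s =
      \<omega>_0/p and r = ln K + s.\<close>
    also have "\<omega> 0 = \<omega> 0 / real p * real k + \<omega> 0 / real p * (real p - real k)"
      using p_pos by (simp add: field_simps)
    finally show "\<omega> k = (ln K + \<omega> 0 / real p) * real k + \<omega> 0 / real p * (real p - real k) + ln (real (p choose k))"
      by (simp add: algebra_simps)
  qed
qed

lemma binomial_imp_recurrence:
  assumes \<alpha>: "\<And>k. k \<le> p \<Longrightarrow> \<alpha> k = \<alpha> 0 + real k / real p * (\<alpha> p - \<alpha> 0)"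
    and \<omega>: "\<And>k. k \<le> p \<Longrightarrow> \<omega> k = r * real k + s * (real p - real k) + ln (real (p choose k))"
    and k: "k < p"
  shows "\<alpha> (Suc k) = \<alpha> k + 1 / real p * (\<alpha> p - \<alpha> 0)"
    and "(\<alpha> (Suc k) - \<alpha> 0) * exp (\<omega> (Suc k)) = exp (r - s) * (\<alpha> p - \<alpha> k) * exp (\<omega> k)"
proof -
  define \<mu> where "\<mu> = 1 / real p * (\<alpha> p - \<alpha> 0)"
  have \<alpha>': "\<alpha> j = \<alpha> 0 + real j * \<mu>" if "j \<le> p" for j
    using \<alpha>[OF that] by (simp add: \<mu>_def)
  show "\<alpha> (Suc k) = \<alpha> k + 1 / real p * (\<alpha> p - \<alpha> 0)"
    unfolding \<mu>_def[symmetric] using \<alpha>'[of k] \<alpha>'[of "Suc k"] k by (simp add: algebra_simps)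
  have z: "exp (\<omega> j) = exp (r * real j + s * (real p - real j)) * real (p choose j)" if "j \<le> p" for j
    using \<omega>[OF that] that by (simp add: exp_add)
  have "\<alpha> (Suc k) - \<alpha> 0 = real (Suc k) * \<mu>"
    using \<alpha>'[of "Suc k"] k by simp
  moreover have "\<alpha> p - \<alpha> k = real (p - k) * \<mu>"
    using \<alpha>'[of p] \<alpha>'[of k] k by (simp add: of_nat_diff algebra_simps)
  \<comment> \<open>One step in k gains an r and loses an s, whence K = exp(r - s).\<close>
  moreover have "exp (r * real (Suc k) + s * (real p - real (Suc k)))
      = exp (r - s) * exp (r * real k + s * (real p - real k))"
    by (simp add: algebra_simps flip: exp_add)
  ultimately have "(\<alpha> (Suc k) - \<alpha> 0) * exp (\<omega> (Suc k))
      = \<mu> * exp (r - s) * exp (r * real k + s * (real p - real k)) * (real (Suc k) * real (p choose Suc k))"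
    using k by (simp only: z Suc_leI mult_ac)
  also have "\<dots> = exp (r - s) * (\<alpha> p - \<alpha> k) * exp (\<omega> k)"
    unfolding Suc_times_binomial_Suc \<open>\<alpha> p - \<alpha> k = _\<close> using k by (simp only: z less_imp_le mult_ac)
  finally show "(\<alpha> (Suc k) - \<alpha> 0) * exp (\<omega> (Suc k)) = exp (r - s) * (\<alpha> p - \<alpha> k) * exp (\<omega> k)" .
qed

section \<open>Constant curvature and the binomial form\<close>

lemma curvature_constant_imp:
  assumes "\<And>\<theta>. curvature \<theta> = c"
  shows "c = 2 / real p"
    and "\<exists>r s. \<forall>k\<le>p. \<alpha> k = \<alpha> 0 + real k / real p * (\<alpha> p - \<alpha> 0) \<and>
      \<omega> k = r * real k + s * (real p - real k) + ln (real (p choose k))"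
proof -
  let ?\<mu> = "c / 2 * (\<alpha> p - \<alpha> 0)"
  obtain K where K: "K > 0" "\<forall>\<theta>. mean \<theta> - \<alpha> 0 = K * exp (?\<mu> * \<theta>) * (\<alpha> p - mean \<theta>)"
    using variance_quadratic_if_curvature_eq[OF assms] variance_quadratic_iff_mean_odds_exponential by blast
  then have rec: "\<alpha> (Suc k) = \<alpha> k + ?\<mu>"
      "(\<alpha> (Suc k) - \<alpha> 0) * exp (\<omega> (Suc k)) = K * (\<alpha> p - \<alpha> k) * exp (\<omega> k)" if "k < p" for k
    using that unfolding mean_odds_exponential_iff_exp_sum_eq exp_sum_eq_iff_recurrence[OF K(1)] by blast+
  \<comment> \<open>The total length of p steps is p \<mu> with \<mu> = (c/2)(\<alpha>_p -
    \<alpha>_0), which determines c.\<close>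
  have "(\<alpha> p - \<alpha> 0) * 1 = (\<alpha> p - \<alpha> 0) * (real p * c / 2)"
    using recurrence_imp_arithmetic[OF rec(1), of p] by (simp add: field_simps)
  then have "1 = real p * c / 2"
    using \<alpha>_less[OF p_pos] by (subst (asm) mult_cancel_left) simp
  then show "c = 2 / real p"
    using p_pos by (simp add: field_simps)
  show "\<exists>r s. \<forall>k\<le>p. \<alpha> k = \<alpha> 0 + real k / real p * (\<alpha> p - \<alpha> 0) \<and>
      \<omega> k = r * real k + s * (real p - real k) + ln (real (p choose k))"
    by (rule recurrence_imp_binomial[OF K(1) rec])
qed

lemma curvature_if_binomial:
  assumes "\<exists>r s. \<forall>k\<le>p. \<alpha> k = \<alpha> 0 + real k / real p * (\<alpha> p - \<alpha> 0) \<and>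
      \<omega> k = r * real k + s * (real p - real k) + ln (real (p choose k))"
  shows "curvature \<theta> = 2 / real p"
proof (rule curvature_eq_if_variance_quadratic)
  obtain r s where rs: "\<And>k. k \<le> p \<Longrightarrow> \<alpha> k = \<alpha> 0 + real k / real p * (\<alpha> p - \<alpha> 0)"
      "\<And>k. k \<le> p \<Longrightarrow> \<omega> k = r * real k + s * (real p - real k) + ln (real (p choose k))"
    using assms by blast
  have K: "exp (r - s) > 0"
    by simp
  \<comment> \<open>The rate is l (\<alpha>_p - \<alpha>_0) with l = 1/p, and l = c/2 gives c =
    2/p.\<close>
  have "\<forall>\<theta>. mean \<theta> - \<alpha> 0 = exp (r - s) * exp (1 / real p * (\<alpha> p - \<alpha> 0) * \<theta>) * (\<alpha> p - mean \<theta>)"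
    unfolding mean_odds_exponential_iff_exp_sum_eq exp_sum_eq_iff_recurrence[OF K]
    using binomial_imp_recurrence[OF rs] by blast
  then have "\<forall>\<theta>. variance \<theta> = 1 / real p * (mean \<theta> - \<alpha> 0) * (\<alpha> p - mean \<theta>)"
    unfolding variance_quadratic_iff_mean_odds_exponential using K by blast
  then show "variance \<theta> = 2 / real p / 2 * (mean \<theta> - \<alpha> 0) * (\<alpha> p - mean \<theta>)" for \<theta>
    by simp
qed

end

section \<open>Reduction of the exponential family to an exponential sum\<close>

context
  fixes \<Omega> :: "'a set" and C F :: "'a \<Rightarrow> real" and \<psi> :: "real \<Rightarrow> real"
    and p :: nat and \<alpha> \<omega> :: "nat \<Rightarrow> real"
  assumes family: "exponential_family \<Omega> C F \<psi>"
    and mono: "strict_mono_on {0..p} \<alpha>"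
    and image: "F ` \<Omega> = \<alpha> ` {0..p}"
    and weight: "\<And>i. i \<le> p \<Longrightarrow> exp (\<omega> i) = (\<Sum>x\<in>{x \<in> \<Omega>. F x = \<alpha> i}. exp (C x))"
begin

lemma exponential_sum_of_family: "exponential_sum p \<alpha>"
proof
  show "p > 0"
  proof (rule ccontr)
    assume "\<not> p > 0"
    \<comment> \<open>If p = 0, then F is constant: a nontrivial linear relation between 1 and
      F.\<close>
    then have "\<forall>x\<in>\<Omega>. - \<alpha> 0 * 1 + 1 * F x = 0"
      using image by auto
    then have "(1::real) = 0"
      using family unfolding exponential_family_def by blast
    then show False
      by simp
  qed
qed (rule mono)

interpretation exponential_sum p \<alpha> \<omega>
  by (rule exponential_sum_of_family)

text \<open>Grouping the points by their value under F collects exactly the sums that define the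
  weights exp(\<omega>_k).\<close>

lemma sum_over_fibres: "(\<Sum>x\<in>\<Omega>. f (F x) * exp (C x)) = (\<Sum>k\<le>p. f (\<alpha> k) * exp (\<omega> k))"
proof -
  have "finite \<Omega>"
    using family by (simp add: exponential_family_def)
  then have "(\<Sum>x\<in>\<Omega>. f (F x) * exp (C x)) = (\<Sum>y\<in>F ` \<Omega>. \<Sum>x\<in>{x \<in> \<Omega>. F x = y}. f (F x) * exp (C x))"
    by (rule sum.image_gen)
  also have "\<dots> = (\<Sum>y\<in>\<alpha> ` {..p}. f y * (\<Sum>x\<in>{x \<in> \<Omega>. F x = y}. exp (C x)))"
    unfolding image atMost_atLeast0 sum_distrib_left by (intro sum.cong refl) simp
  also have "\<dots> = (\<Sum>k\<le>p. f (\<alpha> k) * exp (\<omega> k))"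
    using strict_mono_on_imp_inj_on[OF mono] by (simp add: sum.reindex weight atMost_atLeast0)
  finally show ?thesis .
qed

text \<open>Normalisation of the probabilities forces exp(\<psi>) = Z.\<close>

lemma psi_eq: "\<psi> = (\<lambda>\<theta>. ln (moment 0 \<theta>))"
proof
  fix \<theta>
  have "1 = (\<Sum>x\<in>\<Omega>. prob C F \<psi> x \<theta>)"
    using family by (simp add: exponential_family_def)
  also have "\<dots> = (\<Sum>x\<in>\<Omega>. exp (\<theta> * F x) * exp (C x)) / exp (\<psi> \<theta>)"
    by (simp add: prob_def exp_add exp_diff sum_divide_distrib mult.commute)
  also have "(\<Sum>x\<in>\<Omega>. exp (\<theta> * F x) * exp (C x)) = moment 0 \<theta>"
    unfolding sum_over_fibres[of "\<lambda>y. exp (\<theta> * y)"] by (simp add: moment_def mult.commute)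
  finally have "exp (\<psi> \<theta>) = moment 0 \<theta>"
    by simp
  then show "\<psi> \<theta> = ln (moment 0 \<theta>)"
    by (metis ln_exp)
qed

lemma fisher_eq_variance: "fisher \<Omega> C F \<psi> \<theta> = variance \<theta>"
proof -
  have psi': "(\<psi> has_real_derivative mean \<theta>) (at \<theta>)"
    unfolding psi_eq using moment_0_pos
    by (auto intro!: derivative_eq_intros DERIV_moment simp: mean_def)
  \<comment> \<open>The score is the centred statistic because \<psi>' is the mean; its second
    moment is the variance.\<close>
  have score: "deriv (\<lambda>t. ln (prob C F \<psi> x t)) \<theta> = F x - mean \<theta>" for x
    unfolding prob_def ln_exp
    by (rule DERIV_imp_deriv) (auto intro!: derivative_eq_intros psi')
  have "fisher \<Omega> C F \<psi> \<theta> = (\<Sum>x\<in>\<Omega>. ((F x - mean \<theta>)\<^sup>2 * exp (\<theta> * F x)) * exp (C x)) / moment 0 \<theta>"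
    unfolding fisher_def score using moment_0_pos[of \<theta>]
    by (simp add: prob_def psi_eq exp_add exp_diff sum_divide_distrib mult_ac)
  also have "(\<Sum>x\<in>\<Omega>. ((F x - mean \<theta>)\<^sup>2 * exp (\<theta> * F x)) * exp (C x)) = moment 0 \<theta> * variance \<theta>"
    unfolding sum_over_fibres[of "\<lambda>y. (y - mean \<theta>)\<^sup>2 * exp (\<theta> * y)"] sum_weighted_diff_sq[symmetric]
    by (simp add: mult_ac)
  finally show ?thesis
    by simp
qed

lemma Scal_eq_curvature: "Scal \<Omega> C F \<psi> u = curvature (u $ 1)"
proof -
  have "dombrowski_metric \<Omega> C F \<psi> = (\<lambda>u. mat (variance (u $ 1)))"
    by (simp add: fun_eq_iff dombrowski_metric_def fisher_eq_variance)
  then show ?thesis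
    unfolding Scal_def curvature_def
    using scalar_curvature_conformal[OF variance_pos DERIV_variance DERIV_third_cumulant] by simp
qed

lemma Scal_constant_iff: "Scal \<Omega> C F \<psi> constant_on UNIV \<longleftrightarrow> (\<exists>c. \<forall>\<theta>. curvature \<theta> = c)"
proof -
  \<comment> \<open>Every real number is the first coordinate of some point of the chart.\<close>
  have "(\<forall>u::real^2. curvature (u $ 1) = c) \<longleftrightarrow> (\<forall>\<theta>. curvature \<theta> = c)" for c
    by (metis vector_2(1))
  then show ?thesis
    by (simp add: constant_on_def Scal_eq_curvature)
qed

end

theorem theorem7p9:
  fixes \<Omega> :: "'a set" and C F :: "'a \<Rightarrow> real" and \<psi> :: "real \<Rightarrow> real"
    and p :: nat and \<alpha> \<omega> :: "nat \<Rightarrow> real"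
  assumes "exponential_family \<Omega> C F \<psi>"
    and "strict_mono_on {0..p} \<alpha>"
    and "F ` \<Omega> = \<alpha> ` {0..p}"
    and "\<And>i. i \<le> p \<Longrightarrow> exp (\<omega> i) = (\<Sum>x\<in>{x \<in> \<Omega>. F x = \<alpha> i}. exp (C x))"
  shows "(Scal \<Omega> C F \<psi> constant_on UNIV \<longleftrightarrow>
            (\<exists>r s :: real. \<forall>k\<le>p.
               \<alpha> k = \<alpha> 0 + real k / real p * (\<alpha> p - \<alpha> 0) \<and>
               \<omega> k = r * real k + s * (real p - real k) + ln (real (p choose k))))
         \<and> (Scal \<Omega> C F \<psi> constant_on UNIV \<longrightarrow>
            (\<forall>u. Scal \<Omega> C F \<psi> u = 2 / real p))"
proof -
  interpret exponential_sum p \<alpha> \<omega>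
    by (rule exponential_sum_of_family[OF assms])
  have const: "Scal \<Omega> C F \<psi> constant_on UNIV \<longleftrightarrow> (\<exists>c. \<forall>\<theta>. curvature \<theta> = c)"
    by (rule Scal_constant_iff) (fact assms)+
  have Scal: "Scal \<Omega> C F \<psi> u = curvature (u $ 1)" for u
    by (rule Scal_eq_curvature) (fact assms)+
  show ?thesis
    unfolding const Scal
  proof (intro conjI iffI impI)
    show "\<forall>u::real^2. curvature (u $ 1) = 2 / real p" if "\<exists>c. \<forall>\<theta>. curvature \<theta> = c"
      using that curvature_constant_imp(1) by metis
  next
    assume "\<exists>c. \<forall>\<theta>. curvature \<theta> = c"
    then obtain c where "\<And>\<theta>. curvature \<theta> = c"
      by blast
    then show "\<exists>r s. \<forall>k\<le>p. \<alpha> k = \<alpha> 0 + real k / real p * (\<alpha> p - \<alpha> 0) \<and>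
        \<omega> k = r * real k + s * (real p - real k) + ln (real (p choose k))"
      by (rule curvature_constant_imp(2))
  \<comment> \<open>In the remaining direction, unification supplies 2/p as the constant.\<close>
  qed (intro exI allI, rule curvature_if_binomial)
qed

end
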